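(* Let $n \geq 1$ be an integer and let $P \in \mathbf C[z_1^{\pm1},\dots,z_n^{\pm1}]$ be a Laurent polynomial with $k = k(P) \geq 2$ non-zero coefficients. Let $\kappa = \kappa(P)$. Then for every $\alpha \in (0,1)$ and every $r > 0$, \[ \mu_n(S(P,r)) \leq C_1(n,k)\cdot \alpha^{1-n}\left(\frac{r}{L_\infty(P)}\right)^{\frac{1-\alpha}{\kappa-1}}, \] where $C_1(n,k) := 6k\cdot(18nk^2)^{n-1}$.
   Context: $\mathbf T^n = \{z \in \mathbf C^n : |z_i| = 1\ \forall i\}$ and $\mu_n$ is the probability Haar measure on it. Writing $P = \sum_{v\in\mathbf Z^n} c_v z^v$: $k(P)$ is the number of non-zero $c_v$; $L_\infty(P) := \max_v |c_v|$; for each $i$, $k_i(P)$ is the number of non-zero coefficients of $P$ viewed as a Laurent polynomial in $z_i$ (with coefficients in the other variables), and $\kappa(P) := \max_{1\leq i\leq n} k_i(P)$. For $r \geq 0$, $S(P,r) := \{z \in \mathbf T^n : |P(z)| \leq r\}$. *)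

theory Defs
  imports "HOL-Probability.Probability" "HOL-Library.Poly_Mapping"
begin

(* A Laurent polynomial is an element of the group algebra of the exponent group:
   the exponent of a monomial is a finitely supported map from variable indices to int.
   The variables z_1, ..., z_n are indexed by 0, ..., n - 1. *)
type_synonym laurent = "(nat \<Rightarrow>\<^sub>0 int) \<Rightarrow>\<^sub>0 complex"

definition laurent_polys :: "nat \<Rightarrow> laurent set" where
  "laurent_polys n = {P. \<forall>v\<in>Poly_Mapping.keys P. Poly_Mapping.keys v \<subseteq> {..<n}}"

definition laurent_eval :: "nat \<Rightarrow> laurent \<Rightarrow> (nat \<Rightarrow> complex) \<Rightarrow> complex" where
  "laurent_eval n P z = (\<Sum>v\<in>Poly_Mapping.keys P. Poly_Mapping.lookup P v * (\<Prod>i<n. z i powi Poly_Mapping.lookup v i))"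

definition num_coeffs :: "laurent \<Rightarrow> nat" where
  "num_coeffs P = card {v. Poly_Mapping.lookup P v \<noteq> 0}"

definition L_inf :: "laurent \<Rightarrow> real" where
  "L_inf P = Max (range (\<lambda>v. cmod (Poly_Mapping.lookup P v)))"

(* The coefficient of z_i^m in P, a Laurent polynomial in the remaining variables. *)
definition coeff_in :: "nat \<Rightarrow> laurent \<Rightarrow> int \<Rightarrow> laurent" where
  "coeff_in i P m = (\<Sum>v | v \<in> Poly_Mapping.keys P \<and> Poly_Mapping.lookup v i = m.
     Poly_Mapping.single (v - Poly_Mapping.single i m) (Poly_Mapping.lookup P v))"

definition num_coeffs_in :: "nat \<Rightarrow> laurent \<Rightarrow> nat" where
  "num_coeffs_in i P = card {m. coeff_in i P m \<noteq> 0}"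

definition kappa :: "nat \<Rightarrow> laurent \<Rightarrow> nat" where
  "kappa n P = Max ((\<lambda>i. num_coeffs_in i P) ` {..<n})"

definition torus :: "nat \<Rightarrow> (nat \<Rightarrow> complex) set" where
  "torus n = {..<n} \<rightarrow>\<^sub>E {z. cmod z = 1}"

definition circle_borel :: "complex measure" where
  "circle_borel = restrict_space borel {z. cmod z = 1}"

definition circle_measure :: "complex measure" where
  "circle_measure = distr (uniform_measure lborel {0..<1}) circle_borel (\<lambda>t. cis (2 * pi * t))"

(* The probability Haar measure, constructed as a product of circle measures; the theorem
   is_haar_prob_iff below shows that it is the only translation-invariant Borel probability
   measure on the torus. *)
definition torus_measure :: "nat \<Rightarrow> (nat \<Rightarrow> complex) measure" where
  "torus_measure n = PiM {..<n} (\<lambda>_. circle_measure)"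

definition sublevel :: "nat \<Rightarrow> laurent \<Rightarrow> real \<Rightarrow> (nat \<Rightarrow> complex) set" where
  "sublevel n P r = {z \<in> torus n. cmod (laurent_eval n P z) \<le> r}"

definition C1 :: "nat \<Rightarrow> nat \<Rightarrow> real" where
  "C1 n k = 6 * real k * (18 * real n * real k ^ 2) ^ (n - 1)"

lemma coeff_in_expansion:
  "P = (\<Sum>m\<in>(\<lambda>v. Poly_Mapping.lookup v i) ` Poly_Mapping.keys P. Poly_Mapping.single (Poly_Mapping.single i m) 1 * coeff_in i P m)"
proof -
  have P: "(\<Sum>v\<in>Poly_Mapping.keys P. Poly_Mapping.single v (Poly_Mapping.lookup P v)) = P"
    by (intro poly_mapping_eqI)
       (auto simp: lookup_sum lookup_single when_def not_in_keys_iff_lookup_eq_zero)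
  have "Poly_Mapping.single (Poly_Mapping.single i m) 1 * coeff_in i P m =
      (\<Sum>v | v \<in> Poly_Mapping.keys P \<and> Poly_Mapping.lookup v i = m. Poly_Mapping.single v (Poly_Mapping.lookup P v))" for m
    by (simp add: coeff_in_def sum_distrib_left mult_single)
  then have "(\<Sum>m\<in>(\<lambda>v. Poly_Mapping.lookup v i) ` Poly_Mapping.keys P.
      Poly_Mapping.single (Poly_Mapping.single i m) 1 * coeff_in i P m) =
      (\<Sum>v\<in>Poly_Mapping.keys P. Poly_Mapping.single v (Poly_Mapping.lookup P v))"
    using sum.image_gen[of "Poly_Mapping.keys P" "\<lambda>v. Poly_Mapping.single v (Poly_Mapping.lookup P v)" "\<lambda>v. Poly_Mapping.lookup v i"]
    by simp
  then show ?thesis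
    unfolding P by (rule sym)
qed

lemma lookup_coeff_in:
  "Poly_Mapping.lookup (coeff_in i P m) w = (if Poly_Mapping.lookup w i = 0 then Poly_Mapping.lookup P (w + Poly_Mapping.single i m) else 0)"
proof -
  have "Poly_Mapping.lookup (coeff_in i P m) w =
      (\<Sum>v | v \<in> Poly_Mapping.keys P \<and> Poly_Mapping.lookup v i = m. if v = w + Poly_Mapping.single i m then Poly_Mapping.lookup P v else 0)"
    unfolding coeff_in_def lookup_sum
    by (intro sum.cong) (auto simp: lookup_single when_def)
  also have "\<dots> = (if Poly_Mapping.lookup w i = 0 then Poly_Mapping.lookup P (w + Poly_Mapping.single i m) else 0)"
    by (subst sum.delta) (auto simp: lookup_add in_keys_iff)
  finally show ?thesis .
qed

(* The product sigma-algebra is the Borel sigma-algebra, the circle being second countable. *)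
definition torus_borel :: "nat \<Rightarrow> (nat \<Rightarrow> complex) measure" where
  "torus_borel n = PiM {..<n} (\<lambda>_. circle_borel)"

definition torus_mult :: "nat \<Rightarrow> (nat \<Rightarrow> complex) \<Rightarrow> (nat \<Rightarrow> complex) \<Rightarrow> nat \<Rightarrow> complex" where
  "torus_mult n w z = (\<lambda>i\<in>{..<n}. w i * z i)"

definition is_haar_prob :: "nat \<Rightarrow> (nat \<Rightarrow> complex) measure \<Rightarrow> bool" where
  "is_haar_prob n M \<longleftrightarrow> prob_space M \<and> sets M = sets (torus_borel n) \<and>
     (\<forall>w\<in>torus n. distr M M (torus_mult n w) = M)"

lemma space_circle_borel [simp]: "space circle_borel = {z. cmod z = 1}"
  by (simp add: circle_borel_def space_restrict_space)

lemma space_torus_borel [simp]: "space (torus_borel n) = torus n"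
  by (simp add: torus_borel_def torus_def space_PiM)

lemma measurable_cis_circle [measurable]: "(\<lambda>t. cis (2 * pi * t)) \<in> borel \<rightarrow>\<^sub>M circle_borel"
  unfolding circle_borel_def
  by (rule measurable_restrict_space2)
     (auto intro!: borel_measurable_continuous_onI continuous_intros)

lemma measurable_circle_ident [measurable]: "(\<lambda>z. z) \<in> circle_borel \<rightarrow>\<^sub>M borel"
  unfolding circle_borel_def by (rule measurable_restrict_space1) simp

lemma sets_circle_measure [measurable_cong, simp]: "sets circle_measure = sets circle_borel"
  by (simp add: circle_measure_def)

lemma space_circle_measure [simp]: "space circle_measure = {z. cmod z = 1}"
  by (simp add: circle_measure_def)

lemma prob_space_circle_measure: "prob_space circle_measure"
  unfolding circle_measure_def
  by (intro prob_space.prob_space_distr prob_space_uniform_measure) auto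

lemma sets_torus_measure [measurable_cong, simp]: "sets (torus_measure n) = sets (torus_borel n)"
  unfolding torus_measure_def torus_borel_def by (intro sets_PiM_cong) auto

lemma space_torus_measure [simp]: "space (torus_measure n) = torus n"
  using sets_eq_imp_space_eq[OF sets_torus_measure] by simp

lemma prob_space_torus_measure: "prob_space (torus_measure n)"
  unfolding torus_measure_def by (intro prob_space_PiM prob_space_circle_measure)

lemma emeasure_circle_measure:
  assumes "A \<in> sets circle_borel"
  shows "emeasure circle_measure A = emeasure lborel {t\<in>{0..<1}. cis (2 * pi * t) \<in> A}"
proof -
  have "(\<lambda>t. cis (2 * pi * t)) -` A \<in> sets borel"
    using measurable_sets[OF measurable_cis_circle assms] by simp
  moreover have "{0..<1} \<inter> (\<lambda>t. cis (2 * pi * t)) -` A = {t\<in>{0..<1}. cis (2 * pi * t) \<in> A}"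
    by auto
  moreover have "(\<lambda>t. cis (2 * pi * t)) \<in> uniform_measure lborel {0..<1} \<rightarrow>\<^sub>M circle_borel"
    using measurable_cis_circle by (simp cong: measurable_cong_sets)
  ultimately show ?thesis
    unfolding circle_measure_def by (simp add: emeasure_distr assms divide_ennreal_def)
qed

lemma circle_mult_measurable:
  "cmod w = 1 \<Longrightarrow> (\<lambda>z. w * z) \<in> circle_borel \<rightarrow>\<^sub>M circle_borel"
  unfolding circle_borel_def
  by (intro measurable_restrict_space2 measurable_restrict_space1)
     (auto simp: space_restrict_space norm_mult)

lemma emeasure_lborel_shift:
  assumes [measurable]: "B \<in> sets borel"
  shows "emeasure lborel {t::real. t + c \<in> B} = emeasure lborel B"
proof -
  have "emeasure lborel B = emeasure (distr lborel borel ((+) c)) B"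
    by (simp add: lborel_distr_plus)
  also have "\<dots> = emeasure lborel {t. t + c \<in> B}"
    by (subst emeasure_distr) (auto simp: vimage_def add.commute)
  finally show ?thesis by simp
qed

lemma circle_measure_invariant:
  assumes w: "cmod w = 1"
  shows "distr circle_measure circle_measure (\<lambda>z. w * z) = circle_measure"
proof (rule measure_eqI)
  fix A assume "A \<in> sets (distr circle_measure circle_measure (\<lambda>z. w * z))"
  then have A: "A \<in> sets circle_borel" by simp
  define s where "s = frac (Arg w / (2 * pi))"
  have s: "0 \<le> s" "s < 1" by (auto simp: s_def frac_lt_1)
  have ws: "w = cis (2 * pi * s)"
  proof -
    have "2 * pi * s = Arg w - 2 * pi * of_int \<lfloor>Arg w / (2 * pi)\<rfloor>"
      by (simp add: s_def frac_def field_simps)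
    then have "cis (2 * pi * s) = cis (Arg w)"
      by (simp add: cis_divide[symmetric])
    then show ?thesis
      using w by (metis cis_Arg div_by_1 norm_zero of_real_1 sgn_eq zero_neq_one)
  qed
  define B where "B = {t. cis (2 * pi * t) \<in> A}"
  have B [measurable]: "B \<in> sets borel"
    using measurable_sets[OF measurable_cis_circle A] by (simp add: B_def vimage_def)
  have per: "t + 1 \<in> B \<longleftrightarrow> t \<in> B" for t
    by (simp add: B_def ring_distribs cis_mult[symmetric])
  have wA: "(\<lambda>z. w * z) -` A \<inter> {z. cmod z = 1} \<in> sets circle_borel"
    using measurable_sets[OF circle_mult_measurable[OF w] A] by simp
  have "emeasure (distr circle_measure circle_measure (\<lambda>z. w * z)) A
      = emeasure circle_measure ((\<lambda>z. w * z) -` A \<inter> {z. cmod z = 1})"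
    using A circle_mult_measurable[OF w] by (subst emeasure_distr) (auto cong: measurable_cong_sets)
  also have "\<dots> = emeasure lborel {t. t + s \<in> B \<inter> {s..<s + 1}}"
    by (subst emeasure_circle_measure[OF wA], rule arg_cong[where f = "emeasure lborel"])
       (auto simp: B_def ws cis_mult ring_distribs add.commute)
  also have "\<dots> = emeasure lborel (B \<inter> {s..<s + 1})"
    by (rule emeasure_lborel_shift) simp
  also have "B \<inter> {s..<s + 1} = (B \<inter> {s..<1}) \<union> (B \<inter> {1..<s + 1})"
    using s by auto
  also have "emeasure lborel \<dots> = emeasure lborel (B \<inter> {s..<1}) + emeasure lborel (B \<inter> {1..<s + 1})"
    by (rule plus_emeasure[symmetric]) auto
  also have "emeasure lborel (B \<inter> {1..<s + 1}) = emeasure lborel {t. t + 1 \<in> B \<inter> {1..<s + 1}}"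
    by (rule emeasure_lborel_shift[symmetric]) simp
  also have "{t. t + 1 \<in> B \<inter> {1..<s + 1}} = B \<inter> {0..<s}"
    by (auto simp: per)
  also have "emeasure lborel (B \<inter> {s..<1}) + emeasure lborel (B \<inter> {0..<s})
      = emeasure lborel ((B \<inter> {s..<1}) \<union> (B \<inter> {0..<s}))"
    by (rule plus_emeasure) auto
  also have "(B \<inter> {s..<1}) \<union> (B \<inter> {0..<s}) = {t\<in>{0..<1}. cis (2 * pi * t) \<in> A}"
    using s by (auto simp: B_def)
  finally show "emeasure (distr circle_measure circle_measure (\<lambda>z. w * z)) A = emeasure circle_measure A"
    using emeasure_circle_measure[OF A] by simp
qed simp

lemma is_haar_prob_torus_measure: "is_haar_prob n (torus_measure n)"
proof -
  have "distr (torus_measure n) (torus_measure n) (torus_mult n w) = torus_measure n"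
    if w: "w \<in> torus n" for w
  proof -
    interpret product_sigma_finite "\<lambda>_. circle_measure"
      using prob_space_circle_measure
      by (intro product_sigma_finite.intro) (simp add: prob_space_imp_sigma_finite)
    have w1: "i < n \<Longrightarrow> cmod (w i) = 1" for i
      using w by (auto simp: torus_def PiE_def Pi_def)
    have m: "(\<lambda>z. w i * z) \<in> circle_measure \<rightarrow>\<^sub>M circle_measure" if "i < n" for i
      using circle_mult_measurable[OF w1[OF that]] by (simp cong: measurable_cong_sets)
    have mult: "torus_mult n w \<in> torus_measure n \<rightarrow>\<^sub>M torus_measure n"
      unfolding torus_measure_def torus_mult_def
    proof (rule measurable_restrict)
      fix i assume i: "i \<in> {..<n}"
      have "(\<lambda>z. z i) \<in> PiM {..<n} (\<lambda>_. circle_measure) \<rightarrow>\<^sub>M circle_measure"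
        using i by (rule measurable_component_singleton)
      then show "(\<lambda>z. w i * z i) \<in> PiM {..<n} (\<lambda>_. circle_measure) \<rightarrow>\<^sub>M circle_measure"
        by (rule measurable_compose) (use i m in simp)
    qed
    show ?thesis
      unfolding torus_measure_def
    proof (rule PiM_eqI)
      fix A assume A: "\<And>i. i \<in> {..<n} \<Longrightarrow> A i \<in> sets circle_measure"
      let ?A = "\<lambda>i. (\<lambda>z. w i * z) -` A i \<inter> space circle_measure"
      have A': "?A i \<in> sets circle_measure" if "i < n" for i
        using measurable_sets[OF m[OF that] A] that by simp
      have "torus_mult n w -` (Pi\<^sub>E {..<n} A) \<inter> torus n = Pi\<^sub>E {..<n} ?A"
        by (auto simp: torus_mult_def torus_def PiE_def Pi_def)
      then have "emeasure (distr (torus_measure n) (torus_measure n) (torus_mult n w)) (Pi\<^sub>E {..<n} A)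
          = emeasure (torus_measure n) (Pi\<^sub>E {..<n} ?A)"
        using mult sets_PiM_I_finite[OF finite_lessThan A]
        by (subst emeasure_distr) (auto simp: torus_measure_def[symmetric])
      also have "\<dots> = (\<Prod>i<n. emeasure circle_measure (?A i))"
        unfolding torus_measure_def using A' by (intro emeasure_PiM) auto
      also have "\<dots> = (\<Prod>i<n. emeasure circle_measure (A i))"
      proof (rule prod.cong)
        fix i assume "i \<in> {..<n}"
        then show "emeasure circle_measure (?A i) = emeasure circle_measure (A i)"
          using emeasure_distr[OF m A, of i] circle_measure_invariant[OF w1, of i] by simp
      qed simp
      finally show "emeasure (distr (PiM {..<n} (\<lambda>_. circle_measure)) (PiM {..<n} (\<lambda>_. circle_measure))
          (torus_mult n w)) (Pi\<^sub>E {..<n} A) = (\<Prod>i<n. emeasure circle_measure (A i))"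
        by (simp add: torus_measure_def)
    qed simp_all
  qed
  then show ?thesis
    by (simp add: is_haar_prob_def prob_space_torus_measure)
qed

lemma torus_mult_measurable:
  "(\<lambda>(w, z). torus_mult n w z) \<in> torus_borel n \<Otimes>\<^sub>M torus_borel n \<rightarrow>\<^sub>M torus_borel n"
  unfolding torus_mult_def torus_borel_def split_beta
proof (rule measurable_restrict)
  fix i assume i: "i \<in> {..<n}"
  let ?M = "PiM {..<n} (\<lambda>_. circle_borel)"
  have c: "(\<lambda>z. z i) \<in> ?M \<rightarrow>\<^sub>M circle_borel"
    using i by (rule measurable_component_singleton)
  have [measurable]: "(\<lambda>z. z i) \<in> ?M \<rightarrow>\<^sub>M borel"
    using measurable_compose[OF c measurable_circle_ident] .
  have "(\<lambda>x. fst x i * snd x i) \<in> ?M \<Otimes>\<^sub>M ?M \<rightarrow>\<^sub>M borel"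
    by measurable
  then show "(\<lambda>x. fst x i * snd x i) \<in> ?M \<Otimes>\<^sub>M ?M \<rightarrow>\<^sub>M circle_borel"
    using i unfolding circle_borel_def
    by (intro measurable_restrict_space2)
       (auto simp: space_pair_measure space_PiM norm_mult PiE_def Pi_def space_restrict_space)
qed

theorem is_haar_prob_iff: "is_haar_prob n M \<longleftrightarrow> M = torus_measure n"
proof
  assume M: "is_haar_prob n M"
  let ?T = "torus_measure n"
  interpret M: prob_space M using M by (simp add: is_haar_prob_def)
  interpret T: prob_space ?T by (rule prob_space_torus_measure)
  interpret pair_sigma_finite M ?T ..
  have sM [measurable_cong]: "sets M = sets (torus_borel n)"
    using M by (simp add: is_haar_prob_def)
  then have spM: "space M = torus n"
    using sets_eq_imp_space_eq[of M "torus_borel n"] by simp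
  have inv: "(\<integral>\<^sup>+z. indicator A (torus_mult n w z) \<partial>N) = emeasure N A"
    if N: "is_haar_prob n N" and A: "A \<in> sets (torus_borel n)" and w: "w \<in> torus n" for N A w
  proof -
    have sN: "sets N = sets (torus_borel n)" and d: "distr N N (torus_mult n w) = N"
      using N w by (auto simp: is_haar_prob_def)
    have m: "torus_mult n w \<in> N \<rightarrow>\<^sub>M N"
      using measurable_Pair2[OF torus_mult_measurable, of w n] w sN
      by (simp cong: measurable_cong_sets)
    have "emeasure N A = (\<integral>\<^sup>+z. indicator A z \<partial>distr N N (torus_mult n w))"
      using A sN d by simp
    also have "\<dots> = (\<integral>\<^sup>+z. indicator A (torus_mult n w z) \<partial>N)"
      using A sN by (intro nn_integral_distr m) auto
    finally show ?thesis by simp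
  qed
  show "M = ?T"
  proof (rule measure_eqI)
    fix A assume "A \<in> sets M"
    then have A [measurable]: "A \<in> sets (torus_borel n)" using sM by simp
    have comm: "torus_mult n w z = torus_mult n z w" for w z
      by (simp add: torus_mult_def mult.commute)
    note [measurable] = torus_mult_measurable[unfolded split_beta]
    have meas: "(\<lambda>(x, y). indicator A (torus_mult n x y) :: ennreal) \<in> borel_measurable (M \<Otimes>\<^sub>M ?T)"
      unfolding split_beta by measurable
    have "emeasure ?T A = (\<integral>\<^sup>+x. emeasure ?T A \<partial>M)"
      by (simp add: M.emeasure_space_1)
    also have "\<dots> = (\<integral>\<^sup>+x. \<integral>\<^sup>+y. indicator A (torus_mult n x y) \<partial>?T \<partial>M)"
      by (intro nn_integral_cong) (simp add: inv[OF is_haar_prob_torus_measure A] spM)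
    also have "\<dots> = (\<integral>\<^sup>+y. \<integral>\<^sup>+x. indicator A (torus_mult n x y) \<partial>M \<partial>?T)"
      using Fubini[OF meas] by simp
    also have "\<dots> = (\<integral>\<^sup>+y. emeasure M A \<partial>?T)"
      by (intro nn_integral_cong) (subst comm, simp add: inv[OF M A])
    also have "\<dots> = emeasure M A"
      using T.emeasure_space_1 by simp
    finally show "emeasure M A = emeasure ?T A" by simp
  qed (simp add: sM)
qed (simp add: is_haar_prob_torus_measure)

lemma sublevel_measurable: "sublevel n P r \<in> sets (torus_measure n)"
proof -
  have [measurable]: "(\<lambda>z. z i powi k) \<in> borel_measurable (torus_borel n)" if i: "i < n" for i k
  proof -
    have "(\<lambda>z. z i) \<in> torus_borel n \<rightarrow>\<^sub>M circle_borel"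
      unfolding torus_borel_def using i by (intro measurable_component_singleton) simp
    from measurable_compose[OF this measurable_circle_ident]
    have [measurable]: "(\<lambda>z. z i) \<in> borel_measurable (torus_borel n)" .
    show ?thesis
      by (cases "k \<ge> 0") (simp_all add: power_int_def)
  qed
  have [measurable]: "laurent_eval n P \<in> borel_measurable (torus_borel n)"
    unfolding laurent_eval_def by (intro borel_measurable_sum borel_measurable_times borel_measurable_prod) auto
  have "{z \<in> space (torus_borel n). cmod (laurent_eval n P z) \<le> r} \<in> sets (torus_borel n)"
    by measurable
  then show ?thesis by (simp add: sublevel_def)
qed

end

theory Submission
  imports Defs
begin

text \<open>
  For one variable, let \<open>c\<^sub>j\<close> be a largest coefficient and multiply by a monomial so that the extreme
  exponent farthest from \<open>j\<close> becomes \<open>0\<close>. Differentiation then kills one of the \<open>k\<close> terms, and after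
  division by \<open>D = \<bar>j\<bar>\<close> the coefficient \<open>c\<^sub>j\<close> keeps its modulus while all frequencies are at most \<open>2D\<close>.
  Where the normalised derivative is at least \<open>\<delta>\<close>, the real or the imaginary part of the polynomial
  moves with speed of order \<open>D\<delta>\<close> and is monotone between at most \<open>4D\<close> critical points, so this
  part contributes at most \<open>6r/\<delta>\<close>, independently of \<open>D\<close>; elsewhere induction on the number of terms
  applies. Choosing \<open>\<delta> = r\<^bsup>(k-2)/(k-1)\<^esup>\<close> makes both contributions of order \<open>r\<^bsup>1/(k-1)\<^esup>\<close>.

  For several variables, apply this bound in the last variable to the coefficient \<open>Q\<close>, a Laurent
  polynomial in the others, that contains a largest coefficient of \<open>P\<close>. By Fubini the measure is at
  most \<open>6\<kappa>\<close> times the integral of \<open>min 1 ((r/\<bar>Q\<bar>)\<^bsup>1/(\<kappa>-1)\<^esup>)\<close>, and inserting the inductive bound for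
  the distribution of \<open>\<bar>Q\<bar>\<close> into the layer cake formula costs a factor \<open>1/\<alpha>\<close> and keeps the exponent.
\<close>

subsection \<open>Trigonometric polynomials in one variable\<close>

text \<open>The function is increasing, so while it stays between \<open>- r\<close> and
  \<open>r\<close> it gains at most \<open>2 * r\<close>; on the set in question each unit of length
  contributes at least \<open>c\<close> to this gain.\<close>

lemma measure_sublevel_large_deriv_no_critical:
  fixes g g' :: "real \<Rightarrow> real"
  assumes deriv: "\<And>t. (g has_real_derivative g' t) (at t)"
    and cont: "continuous_on UNIV g'"
    and ab: "a < b" and r: "0 \<le> r" and c: "0 < c"
    and pos: "\<And>t. t \<in> {a<..<b} \<Longrightarrow> 0 < g' t"
  shows "measure lborel {t\<in>{a..b}. \<bar>g t\<bar> \<le> r \<and> c \<le> \<bar>g' t\<bar>} \<le> 2 * r / c"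
proof -
  define U where "U = {t\<in>{a..b}. \<bar>g t\<bar> \<le> r}"
  define E where "E = {t\<in>{a..b}. \<bar>g t\<bar> \<le> r \<and> c \<le> \<bar>g' t\<bar>}"
  have cg: "continuous_on UNIV g"
    using deriv by (meson DERIV_isCont continuous_at_imp_continuous_on)
  have [measurable]: "g \<in> borel_measurable borel" "g' \<in> borel_measurable borel"
    using cg cont by (auto intro: borel_measurable_continuous_onI)
  \<comment> \<open>The extreme points \<open>u\<close> and \<open>w\<close> below may be
    \<open>a\<close> or \<open>b\<close>, where continuity still yields the weak inequality.\<close>
  have nonneg: "0 \<le> g' t" if "t \<in> {a..b}" for t
    using that ab pos
    by (intro continuous_ge_on_closure[of "{a<..<b}" g' t 0])
       (auto intro: continuous_on_subset[OF cont] less_imp_le)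
  show ?thesis
  proof (cases "U = {}")
    case True
    then have "E = {}" by (auto simp: U_def E_def)
    then show ?thesis using r c unfolding E_def[symmetric] by simp
  next
    case False
    have "compact U"
    proof -
      have "closed {t. \<bar>g t\<bar> \<le> r}"
        by (intro closed_Collect_le continuous_intros cg)
      moreover have "U = {a..b} \<inter> {t. \<bar>g t\<bar> \<le> r}" by (auto simp: U_def)
      ultimately show ?thesis by (simp add: compact_Int_closed)
    qed
    then obtain u w where u: "u \<in> U" "\<And>t. t \<in> U \<Longrightarrow> u \<le> t" and w: "w \<in> U" "\<And>t. t \<in> U \<Longrightarrow> t \<le> w"
      using compact_attains_inf[of U] compact_attains_sup[of U] False by metis
    have E [measurable]: "E \<in> sets borel" unfolding E_def by measurable
    have Euw: "E \<subseteq> {u..w}" using u w by (auto simp: E_def U_def)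
    have "ennreal c * emeasure lborel E = (\<integral>\<^sup>+t. ennreal c * indicator E t \<partial>lborel)"
      by (simp add: nn_integral_cmult_indicator)
    also have "\<dots> \<le> (\<integral>\<^sup>+t. ennreal (g' t) * indicator {u..w} t \<partial>lborel)"
      using Euw nonneg by (intro nn_integral_mono) (fastforce simp: E_def indicator_def intro!: ennreal_leI)
    also have "\<dots> = ennreal (g w - g u)"
      using u w nonneg by (intro nn_integral_FTC_Icc)
        (auto simp: U_def intro: deriv has_field_derivative_at_within)
    also have "\<dots> \<le> ennreal (2 * r)"
      using u w by (intro ennreal_leI) (auto simp: U_def)
    finally have *: "ennreal c * emeasure lborel E \<le> ennreal (2 * r)" .
    have fin: "emeasure lborel E \<noteq> \<infinity>"
      using Euw emeasure_mono[of E "{u..w}" lborel] by (auto simp: top_unique emeasure_lborel_Icc_eq split: if_splits)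
    have "c * measure lborel E \<le> 2 * r"
      using * fin c r by (simp add: emeasure_eq_ennreal_measure ennreal_mult''[symmetric])
    then show ?thesis using c by (simp add: E_def field_simps)
  qed
qed

text \<open>Between consecutive critical points the derivative has constant sign, so the previous
  bound applies to each piece. The induction cuts the interval at an arbitrary critical
  point.\<close>

lemma measure_sublevel_large_deriv:
  fixes g g' :: "real \<Rightarrow> real"
  assumes deriv: "\<And>t. (g has_real_derivative g' t) (at t)"
    and cont: "continuous_on UNIV g'"
    and ab: "a < b" and r: "0 \<le> r" and c: "0 < c"
    and fin: "finite {t\<in>{a<..<b}. g' t = 0}"
  shows "measure lborel {t\<in>{a..b}. \<bar>g t\<bar> \<le> r \<and> c \<le> \<bar>g' t\<bar>}
    \<le> (real (card {t\<in>{a<..<b}. g' t = 0}) + 1) * (2 * r / c)"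
  using ab fin
proof (induction "card {t\<in>{a<..<b}. g' t = 0}" arbitrary: a b rule: less_induct)
  case (less a b)
  define E where "E a b = {t\<in>{a..b}. \<bar>g t\<bar> \<le> r \<and> c \<le> \<bar>g' t\<bar>}" for a b
  define Z where "Z a b = {t\<in>{a<..<b}. g' t = 0}" for a b
  have cg: "continuous_on UNIV g"
    using deriv by (meson DERIV_isCont continuous_at_imp_continuous_on)
  have [measurable]: "g \<in> borel_measurable borel" "g' \<in> borel_measurable borel"
    using cg cont by (auto intro: borel_measurable_continuous_onI)
  have E [measurable]: "E a b \<in> sets borel" for a b unfolding E_def by measurable
  show ?case
  proof (cases "Z a b = {}")
    case True
    have nz: "g' t \<noteq> 0" if "t \<in> {a<..<b}" for t
      using True that by (auto simp: Z_def)
    have sgn: "(\<forall>t\<in>{a<..<b}. 0 < g' t) \<or> (\<forall>t\<in>{a<..<b}. g' t < 0)"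
    proof (rule ccontr)
      assume "\<not> ?thesis"
      then obtain s t where st: "s \<in> {a<..<b}" "t \<in> {a<..<b}" "g' s \<le> 0" "0 \<le> g' t"
        by (meson not_less)
      have "connected (g' ` {a<..<b})"
        by (intro connected_continuous_image continuous_on_subset[OF cont]) auto
      then have "0 \<in> g' ` {a<..<b}"
        using st by (meson connectedD_interval imageI)
      then show False using nz by auto
    qed
    have "measure lborel (E a b) \<le> 2 * r / c"
      using sgn
    proof
      assume "\<forall>t\<in>{a<..<b}. 0 < g' t"
      then show ?thesis
        unfolding E_def by (intro measure_sublevel_large_deriv_no_critical deriv cont less.prems r c) auto
    next
      assume *: "\<forall>t\<in>{a<..<b}. g' t < 0"
      have "measure lborel {t\<in>{a..b}. \<bar>- g t\<bar> \<le> r \<and> c \<le> \<bar>- g' t\<bar>} \<le> 2 * r / c"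
        using * by (intro measure_sublevel_large_deriv_no_critical less.prems r c)
          (auto intro!: deriv derivative_intros continuous_intros cont)
      then show ?thesis by (simp add: E_def)
    qed
    then show ?thesis
      unfolding E_def[symmetric] Z_def[symmetric] using True by simp
  next
    case False
    then obtain z where z: "a < z" "z < b" "g' z = 0" by (auto simp: Z_def)
    have f: "finite (Z a b)" using less.prems by (simp add: Z_def)
    have ZZ: "Z a b = insert z (Z a z \<union> Z z b)" using z by (auto simp: Z_def)
    then have f': "finite (Z a z)" "finite (Z z b)" using f by auto
    \<comment> \<open>The cut point itself lies in neither half, so the number of zeros plus one is
      additive under the cut.\<close>
    have card: "card (Z a b) = card (Z a z) + card (Z z b) + 1"
    proof -
      have "card (Z a z \<union> Z z b) = card (Z a z) + card (Z z b)"
        using f' by (intro card_Un_disjoint) (auto simp: Z_def)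
      moreover have "z \<notin> Z a z \<union> Z z b" by (auto simp: Z_def)
      ultimately show ?thesis using f' ZZ by simp
    qed
    have 1: "measure lborel (E a z) \<le> (real (card (Z a z)) + 1) * (2 * r / c)"
      using less.hyps[of a z] card f' z by (simp add: E_def Z_def)
    have 2: "measure lborel (E z b) \<le> (real (card (Z z b)) + 1) * (2 * r / c)"
      using less.hyps[of z b] card f' z by (simp add: E_def Z_def)
    have "E a b = E a z \<union> E z b" using z by (auto simp: E_def)
    then have "measure lborel (E a b) \<le> measure lborel (E a z) + measure lborel (E z b)"
      by (simp add: measure_Un_le)
    also have "\<dots> \<le> (real (card (Z a b)) + 1) * (2 * r / c)"
      using add_mono[OF 1 2] unfolding card distrib_right[symmetric] by (simp add: algebra_simps)
    finally show ?thesis by (simp add: E_def Z_def)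
  qed
qed

section \<open>Trigonometric polynomials where the derivative is large\<close>

text \<open>For \<open>z = cis (2 * pi * t)\<close> conjugation is inversion, so
  \<open>z ^ N\<close> times twice the real part is a polynomial \<open>p\<close> in
  \<open>z\<close> of degree at most \<open>2 * N\<close>. The point \<open>t0\<close> ensures that
  \<open>p\<close> is non-zero.\<close>

lemma card_zeros_trig_poly:
  fixes b :: "int \<Rightarrow> complex"
  assumes "finite B" and N: "\<And>m. m \<in> B \<Longrightarrow> \<bar>m\<bar> \<le> int N"
    and nz: "Re (\<Sum>m\<in>B. b m * cis (2 * pi * of_int m * t0)) \<noteq> 0"
  shows "finite {t\<in>{0<..<1}. Re (\<Sum>m\<in>B. b m * cis (2 * pi * of_int m * t)) = 0}" (is "finite ?Z")
    and "card {t\<in>{0<..<1}. Re (\<Sum>m\<in>B. b m * cis (2 * pi * of_int m * t)) = 0} \<le> 2 * N"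
proof -
  define p where "p = (\<Sum>m\<in>B. monom (b m) (nat (int N + m)) + monom (cnj (b m)) (nat (int N - m)))"
  define h where "h t = Re (\<Sum>m\<in>B. b m * cis (2 * pi * of_int m * t))" for t
  have p: "poly p (cis (2 * pi * t)) = cis (2 * pi * real N * t) * of_real (2 * h t)" for t
  proof -
    have 1: "cis (2 * pi * t) ^ nat (int N + s) = cis (2 * pi * real N * t) * cis (2 * pi * of_int s * t)"
      if "\<bar>s\<bar> \<le> int N" for s
    proof -
      have *: "real (nat (int N + s)) = real N + of_int s" using that by linarith
      show ?thesis unfolding Complex.DeMoivre * cis_mult by (simp add: algebra_simps)
    qed
    have "poly p (cis (2 * pi * t)) = (\<Sum>m\<in>B. cis (2 * pi * real N * t) *
        (b m * cis (2 * pi * of_int m * t) + cnj (b m * cis (2 * pi * of_int m * t))))"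
      unfolding p_def poly_sum
    proof (intro sum.cong refl)
      fix m assume "m \<in> B"
      then show "poly (monom (b m) (nat (int N + m)) + monom (cnj (b m)) (nat (int N - m))) (cis (2 * pi * t)) =
        cis (2 * pi * real N * t) * (b m * cis (2 * pi * of_int m * t) + cnj (b m * cis (2 * pi * of_int m * t)))"
        using 1[of m] 1[of "-m"] N[of m] by (simp add: poly_monom cis_cnj algebra_simps)
    qed
    also have "\<dots> = cis (2 * pi * real N * t) * of_real (2 * h t)"
      by (simp only: complex_add_cnj sum_distrib_left[symmetric] h_def Re_sum of_real_sum[symmetric])
    finally show ?thesis .
  qed
  have "p \<noteq> 0"
    using p[of t0] nz[folded h_def] by auto
  have deg: "degree p \<le> 2 * N"
    unfolding p_def
  proof (intro degree_sum_le assms(1))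
    fix m assume "m \<in> B"
    then show "degree (monom (b m) (nat (int N + m)) + monom (cnj (b m)) (nat (int N - m))) \<le> 2 * N"
      using N[of m] by (intro degree_add_le order.trans[OF degree_monom_le]) auto
  qed
  \<comment> \<open>Equal values force \<open>s - t\<close> to be an integer, and two points of the
    open unit interval differ by less than 1.\<close>
  have inj: "inj_on (\<lambda>t. cis (2 * pi * t)) ?Z"
  proof (rule inj_onI)
    fix s t assume "s \<in> ?Z" "t \<in> ?Z" "cis (2 * pi * s) = cis (2 * pi * t)"
    then have st: "0 < s" "s < 1" "0 < t" "t < 1" "cis (2 * pi * s - 2 * pi * t) = 1"
      by (auto simp: cis_divide[symmetric])
    then obtain k :: int where "2 * pi * s - 2 * pi * t = of_int k * (2 * pi)"
      by (auto simp: complex_eq_iff cos_one_2pi_int)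
    then have "(2 * pi) * (s - t) = (2 * pi) * of_int k" by (simp add: algebra_simps)
    then have "s - t = of_int k" unfolding mult_cancel_left by simp
    with st have "k = 0" by linarith
    with \<open>s - t = of_int k\<close> show "s = t" by simp
  qed
  have sub: "(\<lambda>t. cis (2 * pi * t)) ` ?Z \<subseteq> {z. poly p z = 0}"
    using p by (auto simp: h_def[symmetric] simp del: Re_sum)
  have fin: "finite {z. poly p z = 0}" using \<open>p \<noteq> 0\<close> by (rule poly_roots_finite)
  show "finite ?Z"
    using inj sub fin by (meson finite_imageD finite_subset)
  have "card ?Z = card ((\<lambda>t. cis (2 * pi * t)) ` ?Z)" using inj by (simp add: card_image)
  also have "\<dots> \<le> card {z. poly p z = 0}" using sub fin by (rule card_mono[rotated])
  also have "\<dots> \<le> degree p" using \<open>p \<noteq> 0\<close> by (rule card_poly_roots_bound)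
  finally show "card ?Z \<le> 2 * N" using deg by simp
qed

text \<open>\<open>Re (G' t)\<close> is again the real part of a trigonometric polynomial with the
  same frequencies, so it has at most \<open>2 * N\<close> zeros in the open unit interval unless it
  vanishes identically; in that case the set is empty because \<open>s\<close> is positive.\<close>

lemma measure_trig_poly_large_Re_deriv:
  fixes c :: "int \<Rightarrow> complex" and A :: "int set"
  defines "G \<equiv> \<lambda>t::real. \<Sum>m\<in>A. c m * cis (2 * pi * of_int m * t)"
    and "G' \<equiv> \<lambda>t::real. \<Sum>m\<in>A. 2 * pi * \<i> * of_int m * c m * cis (2 * pi * of_int m * t)"
  assumes A: "finite A" and N: "\<And>m. m \<in> A \<Longrightarrow> \<bar>m\<bar> \<le> int N" and r: "0 \<le> r" and s: "0 < s"
  shows "measure lborel {t\<in>{0..1}. \<bar>Re (G t)\<bar> \<le> r \<and> s \<le> \<bar>Re (G' t)\<bar>} \<le> (2 * real N + 1) * (2 * r / s)"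
proof (cases "\<forall>t. Re (G' t) = 0")
  case True
  then have "{t\<in>{0..1}. \<bar>Re (G t)\<bar> \<le> r \<and> s \<le> \<bar>Re (G' t)\<bar>} = {}" using s by auto
  then show ?thesis using r s by (simp only: measure_empty) simp
next
  case False
  then obtain t0 where t0: "Re (G' t0) \<noteq> 0" by auto
  note z = card_zeros_trig_poly[OF A N t0[unfolded G'_def]]
  have "((\<lambda>t. Re (G t)) has_real_derivative Re (G' t)) (at t)" for t
    unfolding G_def G'_def Re_sum
    by (intro DERIV_sum) (auto intro!: derivative_eq_intros simp: algebra_simps)
  moreover have "continuous_on UNIV (\<lambda>t. Re (G' t))"
    unfolding G'_def by (intro continuous_intros)
  ultimately have "measure lborel {t\<in>{0..1}. \<bar>Re (G t)\<bar> \<le> r \<and> s \<le> \<bar>Re (G' t)\<bar>}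
      \<le> (real (card {t\<in>{0<..<1}. Re (G' t) = 0}) + 1) * (2 * r / s)"
    using z(1) r s by (intro measure_sublevel_large_deriv) (auto simp: G'_def)
  also have "\<dots> \<le> (2 * real N + 1) * (2 * r / s)"
    using z(2) r s by (intro mult_right_mono) (auto simp: G'_def)
  finally show ?thesis .
qed

text \<open>A small \<open>G\<close> has small real and imaginary parts, and a large
  \<open>G'\<close> has a large real or a large imaginary part. So the set is covered by two sets of
  the previous kind, each contributing \<open>(2 * N + 1) * (3 * r / s)\<close>.\<close>

lemma measure_trig_poly_large_deriv:
  fixes c :: "int \<Rightarrow> complex" and A :: "int set"
  defines "G \<equiv> \<lambda>t::real. \<Sum>m\<in>A. c m * cis (2 * pi * of_int m * t)"
    and "G' \<equiv> \<lambda>t::real. \<Sum>m\<in>A. 2 * pi * \<i> * of_int m * c m * cis (2 * pi * of_int m * t)"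
  assumes A: "finite A" and N: "\<And>m. m \<in> A \<Longrightarrow> \<bar>m\<bar> \<le> int N" and r: "0 \<le> r" and s: "0 < s"
  shows "measure lborel {t\<in>{0..1}. cmod (G t) \<le> r \<and> s \<le> cmod (G' t)} \<le> 6 * (2 * real N + 1) * r / s"
proof -
  \<comment> \<open>any factor below \<open>1 / sqrt 2\<close> works; \<open>2 / 3\<close> keeps the constants rational\<close>
  define s' where "s' = 2 * s / 3"
  define R where "R = {t\<in>{0..1}. \<bar>Re (G t)\<bar> \<le> r \<and> s' \<le> \<bar>Re (G' t)\<bar>}"
  define I where "I = {t\<in>{0..1}. \<bar>Im (G t)\<bar> \<le> r \<and> s' \<le> \<bar>Im (G' t)\<bar>}"
  have s': "0 < s'" using s by (simp add: s'_def)
  have [measurable]: "G \<in> borel_measurable borel" "G' \<in> borel_measurable borel"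
    unfolding G_def G'_def by (auto intro!: borel_measurable_continuous_onI continuous_intros)
  have [measurable]: "R \<in> sets borel" "I \<in> sets borel"
    unfolding R_def I_def by measurable
  have R: "measure lborel R \<le> (2 * real N + 1) * (2 * r / s')"
    unfolding R_def G_def G'_def by (rule measure_trig_poly_large_Re_deriv[OF A N r s'])
  \<comment> \<open>Imaginary parts become real parts after multiplication by \<open>- \<i>\<close>,
    so the real-part estimate applies to the coefficients \<open>- \<i> * c m\<close>.\<close>
  have "I = {t\<in>{0..1}. \<bar>Re (\<Sum>m\<in>A. (- \<i> * c m) * cis (2 * pi * of_int m * t))\<bar> \<le> r \<and>
      s' \<le> \<bar>Re (\<Sum>m\<in>A. 2 * pi * \<i> * of_int m * (- \<i> * c m) * cis (2 * pi * of_int m * t))\<bar>}"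
  proof -
    have *: "Im z = Re (- \<i> * z)" for z by simp
    show ?thesis
      unfolding I_def * G_def G'_def sum_distrib_left by (simp only: mult_ac)
  qed
  then have I: "measure lborel I \<le> (2 * real N + 1) * (2 * r / s')"
    using measure_trig_poly_large_Re_deriv[OF A N r s', of "\<lambda>m. - \<i> * c m"] by simp
  have "{t\<in>{0..1}. cmod (G t) \<le> r \<and> s \<le> cmod (G' t)} \<subseteq> R \<union> I"
  proof
    fix t assume t: "t \<in> {t\<in>{0..1}. cmod (G t) \<le> r \<and> s \<le> cmod (G' t)}"
    have "s' \<le> \<bar>Re (G' t)\<bar> \<or> s' \<le> \<bar>Im (G' t)\<bar>"
    proof (rule ccontr)
      assume "\<not> ?thesis"
      then have "(Re (G' t))\<^sup>2 \<le> s'\<^sup>2" "(Im (G' t))\<^sup>2 \<le> s'\<^sup>2"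
        by (auto simp: abs_le_square_iff[symmetric])
      then have "(cmod (G' t))\<^sup>2 \<le> 8 / 9 * s\<^sup>2"
        by (simp add: cmod_power2 s'_def power_divide power_mult_distrib)
      moreover have "s\<^sup>2 \<le> (cmod (G' t))\<^sup>2" using t s by (intro power_mono) auto
      moreover have "0 < s\<^sup>2" using s by simp
      ultimately show False by simp
    qed
    then show "t \<in> R \<union> I"
      using t order.trans[OF abs_Re_le_cmod, of "G t" r] order.trans[OF abs_Im_le_cmod, of "G t" r]
      by (auto simp: R_def I_def)
  qed
  moreover have "emeasure lborel (R \<union> I) < \<infinity>"
  proof -
    have "emeasure lborel (R \<union> I) \<le> emeasure lborel {0..1::real}"
      by (intro emeasure_mono) (auto simp: R_def I_def)
    then show ?thesis by (simp add: le_less_trans)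
  qed
  ultimately have "measure lborel {t\<in>{0..1}. cmod (G t) \<le> r \<and> s \<le> cmod (G' t)} \<le> measure lborel (R \<union> I)"
    by (intro measure_mono_fmeasurable) (auto simp: fmeasurable_def)
  also have "\<dots> \<le> measure lborel R + measure lborel I"
    by (intro measure_Un_le) auto
  also have "\<dots> \<le> 6 * (2 * real N + 1) * r / s"
    using R I s by (simp add: s'_def field_simps)
  finally show ?thesis .
qed

section \<open>Induction on the number of terms\<close>

text \<open>The diameter of \<open>A\<close> is the sum of the distances from \<open>j\<close> to
  the two extremes, hence at most twice the larger of them; \<open>i\<close> is the farther
  extreme.\<close>

lemma obtain_far_extreme:
  fixes A :: "int set"
  assumes "finite A" "j \<in> A" "A \<noteq> {j}"
  obtains i where "i \<in> A" "i \<noteq> j" "\<And>m. m \<in> A \<Longrightarrow> \<bar>m - i\<bar> \<le> 2 * \<bar>j - i\<bar>"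
proof -
  have ne: "A \<noteq> {}" using assms by auto
  have mm: "Min A \<le> m" "m \<le> Max A" if "m \<in> A" for m using that assms by auto
  have M: "Min A \<in> A" "Max A \<in> A" using assms ne by auto
  obtain l where l: "l \<in> A" "l \<noteq> j" using assms by auto
  show ?thesis
  proof (cases "Max A - j \<le> j - Min A")
    case True
    show ?thesis
    proof (rule that[of "Min A"])
      show "Min A \<noteq> j" using True l mm[OF l(1)] by linarith
      show "\<bar>m - Min A\<bar> \<le> 2 * \<bar>j - Min A\<bar>" if "m \<in> A" for m
        using True mm[OF that] mm[OF assms(2)] by (simp add: abs_if)
    qed (use M in simp)
  next
    case False
    show ?thesis
    proof (rule that[of "Max A"])
      show "Max A \<noteq> j" using False mm[of j] assms by auto
      show "\<bar>m - Max A\<bar> \<le> 2 * \<bar>j - Max A\<bar>" if "m \<in> A" for m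
        using False mm[OF that] mm[OF assms(2)] by (simp add: abs_if)
    qed (use M in simp)
  qed
qed

text \<open>Dividing by the monomial of frequency \<open>i\<close> keeps all moduli and makes term
  \<open>i\<close> constant, so that differentiation removes it. The bound on the number of monotone
  pieces and the size of the unnormalised derivative both grow like
  \<open>\<bar>j - i\<bar>\<close>, which therefore cancels.\<close>

lemma measure_trig_poly_deriv_step:
  fixes c :: "int \<Rightarrow> complex" and A :: "int set"
  assumes A: "finite A" and ij: "i \<in> A" "i \<noteq> j"
    and far: "\<And>m. m \<in> A \<Longrightarrow> \<bar>m - i\<bar> \<le> 2 * \<bar>j - i\<bar>" and r: "0 \<le> r" and s: "0 < s"
  shows "measure lborel {t\<in>{0..1}. cmod (\<Sum>m\<in>A. c m * cis (2 * pi * of_int m * t)) \<le> r \<and>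
      s \<le> cmod (\<Sum>m\<in>A - {i}. (c m * of_int (m - i) / of_int (j - i)) * cis (2 * pi * of_int m * t))}
    \<le> 6 * r / s"
proof -
  define D where "D = nat \<bar>j - i\<bar>"
  define B where "B = (\<lambda>m. m - i) ` A"
  have D: "real D = \<bar>real_of_int j - real_of_int i\<bar>" "1 \<le> D" using ij by (auto simp: D_def)
  have inj: "inj_on (\<lambda>m. m - i) A" by (auto simp: inj_on_def)
  have shift: "cis (2 * pi * of_int (m - i) * t) = cis (- (2 * pi * of_int i * t)) * cis (2 * pi * of_int m * t)"
    for m and t :: real
    by (simp add: cis_mult algebra_simps)
  have G: "cmod (\<Sum>m\<in>B. c (m + i) * cis (2 * pi * of_int m * t)) =
      cmod (\<Sum>m\<in>A. c m * cis (2 * pi * of_int m * t))" for t :: real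
  proof -
    have "(\<Sum>m\<in>B. c (m + i) * cis (2 * pi * of_int m * t)) =
        cis (- (2 * pi * of_int i * t)) * (\<Sum>m\<in>A. c m * cis (2 * pi * of_int m * t))"
      unfolding B_def sum.reindex[OF inj] o_def shift sum_distrib_left by (simp add: mult_ac)
    then show ?thesis by (simp only: norm_mult norm_cis mult_1)
  qed
  have G': "cmod (\<Sum>m\<in>B. 2 * pi * \<i> * of_int m * c (m + i) * cis (2 * pi * of_int m * t)) = 2 * pi * real D *
      cmod (\<Sum>m\<in>A - {i}. (c m * of_int (m - i) / of_int (j - i)) * cis (2 * pi * of_int m * t))" for t :: real
  proof -
    have "(\<Sum>m\<in>B. 2 * pi * \<i> * of_int m * c (m + i) * cis (2 * pi * of_int m * t)) =
      (\<Sum>m\<in>A. 2 * pi * \<i> * of_int (m - i) * c m * cis (2 * pi * of_int (m - i) * t))"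
      unfolding B_def sum.reindex[OF inj] o_def by simp
    also have "\<dots> = (\<Sum>m\<in>A - {i}. 2 * pi * \<i> * of_int (m - i) * c m * cis (2 * pi * of_int (m - i) * t))"
      using A ij by (simp add: sum.remove)
    also have "\<dots> = (2 * pi * \<i> * of_int (j - i) * cis (- (2 * pi * of_int i * t))) *
      (\<Sum>m\<in>A - {i}. (c m * of_int (m - i) / of_int (j - i)) * cis (2 * pi * of_int m * t))"
      unfolding shift sum_distrib_left using ij by (intro sum.cong refl) (simp add: field_simps)
    finally show ?thesis
      by (simp only: norm_mult norm_cis norm_of_real norm_of_int D norm_ii of_int_diff[symmetric]) simp
  qed
  have "measure lborel {t\<in>{0..1}. cmod (\<Sum>m\<in>B. c (m + i) * cis (2 * pi * of_int m * t)) \<le> r \<and>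
      2 * pi * real D * s \<le> cmod (\<Sum>m\<in>B. 2 * pi * \<i> * of_int m * c (m + i) * cis (2 * pi * of_int m * t))}
    \<le> 6 * (2 * real (2 * D) + 1) * r / (2 * pi * real D * s)"
  proof (rule measure_trig_poly_large_deriv[OF _ _ r])
    show "finite B" using A by (simp add: B_def)
    show "\<bar>m\<bar> \<le> int (2 * D)" if "m \<in> B" for m using that far by (auto simp: B_def D_def)
    show "0 < 2 * pi * real D * s" using D s by simp
  qed
  also have "\<dots> \<le> 6 * r / s"
  proof -
    have "6 * (2 * real (2 * D) + 1) * r / (2 * pi * real D * s) = ((2 * real (2 * D) + 1) / (2 * pi * real D)) * (6 * r / s)"
      using D s by (simp add: field_simps)
    \<comment> \<open>Since \<open>1 \<le> D\<close>, the numerator \<open>4 * D + 1\<close> is at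
      most \<open>5 * D\<close>, and \<open>5 < 2 * pi\<close>.\<close>
    moreover have "(2 * real (2 * D) + 1) / (2 * pi * real D) \<le> 1"
    proof -
      have "5 * real D \<le> 2 * pi * real D" using pi_gt3 by (intro mult_right_mono) auto
      then show ?thesis using D by (simp add: divide_le_eq)
    qed
    ultimately show ?thesis
      using mult_right_mono[of "(2 * real (2 * D) + 1) / (2 * pi * real D)" 1 "6 * r / s"] r s by simp
  qed
  finally have "measure lborel {t\<in>{0..1}. cmod (\<Sum>m\<in>B. c (m + i) * cis (2 * pi * of_int m * t)) \<le> r \<and>
      2 * pi * real D * s \<le> cmod (\<Sum>m\<in>B. 2 * pi * \<i> * of_int m * c (m + i) * cis (2 * pi * of_int m * t))}
    \<le> 6 * r / s" .
  moreover have "2 * pi * real D * s \<le> 2 * pi * real D * x \<longleftrightarrow> s \<le> x" for x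
    using D by (intro mult_le_cancel_left_pos) simp
  ultimately show ?thesis
    unfolding G G' by (simp only:)
qed

text \<open>Disposes of the degenerate cases of the induction: if \<open>cmod (c j) \<le> r\<close>
  the right-hand side is at least 1, and otherwise a single term has constant modulus above
  \<open>r\<close>, so the set is empty.\<close>

lemma measure_trig_poly_le_trivial:
  fixes c :: "int \<Rightarrow> complex" and A :: "int set"
  assumes "A = {j} \<or> cmod (c j) \<le> r" "1 \<le> k" "c j \<noteq> 0" "0 < r"
  shows "measure lborel {t\<in>{0..1}. cmod (\<Sum>m\<in>A. c m * cis (2 * pi * of_int m * t)) \<le> r}
    \<le> 6 * real k * (r / cmod (c j)) powr (1 / real k)"
proof (cases "cmod (c j) \<le> r")
  case True
  have [measurable]: "(\<lambda>t::real. \<Sum>m\<in>A. c m * cis (2 * pi * of_int m * t)) \<in> borel_measurable borel"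
    by (auto intro!: borel_measurable_continuous_onI continuous_intros)
  have "measure lborel {t\<in>{0..1}. cmod (\<Sum>m\<in>A. c m * cis (2 * pi * of_int m * t)) \<le> r} \<le> measure lborel {0..1::real}"
    by (intro measure_mono_fmeasurable) (auto simp: fmeasurable_def)
  also have "\<dots> \<le> 6 * real k * 1" using assms by simp
  also have "\<dots> \<le> 6 * real k * (r / cmod (c j)) powr (1 / real k)"
    using True assms by (intro mult_left_mono ge_one_powr_ge_zero) auto
  finally show ?thesis .
next
  case False
  then have "{t\<in>{0..1}. cmod (\<Sum>m\<in>A. c m * cis (2 * pi * of_int m * t)) \<le> r} = {}"
    using assms by (auto simp: norm_mult)
  then show ?thesis by (simp only: measure_empty) simp
qed

text \<open>The term \<open>j\<close> stays fixed through the induction, since its coefficient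
  survives each normalised differentiation. It may be any non-zero coefficient; this freedom is used
  once the coefficients depend on further variables.\<close>

lemma measure_trig_poly_le:
  fixes c :: "int \<Rightarrow> complex" and A :: "int set"
  assumes "finite A" "card A \<le> k + 1" "1 \<le> k" "j \<in> A" "c j \<noteq> 0" "0 < r"
  shows "measure lborel {t\<in>{0..1}. cmod (\<Sum>m\<in>A. c m * cis (2 * pi * of_int m * t)) \<le> r}
    \<le> 6 * real k * (r / cmod (c j)) powr (1 / real k)"
  using assms(3,1,2,4-)
proof (induction k arbitrary: A c r rule: nat_induct_at_least)
  case (base A c r)
  show ?case
  proof (cases "A = {j} \<or> cmod (c j) \<le> r")
    case True
    then show ?thesis using base by (intro measure_trig_poly_le_trivial) auto
  next
    case False
    then obtain i where i: "i \<in> A" "i \<noteq> j" "\<And>m. m \<in> A \<Longrightarrow> \<bar>m - i\<bar> \<le> 2 * \<bar>j - i\<bar>"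
      using obtain_far_extreme[of A j] base by auto
    \<comment> \<open>With two terms the normalised derivative is the single term \<open>j\<close>,
      of constant modulus \<open>cmod (c j)\<close>, so the derivative step covers the whole
      sublevel set.\<close>
    have "{j} \<union> {i} = A"
      using i base by (intro card_seteq) auto
    then have "A - {i} = {j}" using i by auto
    then have "cmod (\<Sum>m\<in>A - {i}. (c m * of_int (m - i) / of_int (j - i)) * cis (2 * pi * of_int m * t)) = cmod (c j)"
      for t :: real
      using i(2) by (simp add: norm_mult)
    then show ?thesis
      using measure_trig_poly_deriv_step[OF base(1) i, of r "cmod (c j)" c] base by simp
  qed
next
  case (Suc k A c r)
  define \<rho> where "\<rho> = r / cmod (c j)"
  have \<rho>: "0 < \<rho>" using Suc by (simp add: \<rho>_def)
  show ?case
  proof (cases "A = {j} \<or> cmod (c j) \<le> r")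
    case True
    then show ?thesis using Suc.prems by (intro measure_trig_poly_le_trivial) auto
  next
    case False
    then obtain i where i: "i \<in> A" "i \<noteq> j" "\<And>m. m \<in> A \<Longrightarrow> \<bar>m - i\<bar> \<le> 2 * \<bar>j - i\<bar>"
      using obtain_far_extreme[of A j] Suc.prems by auto
    define c' where "c' m = c m * of_int (m - i) / of_int (j - i)" for m
    \<comment> \<open>This exponent balances the two parts: \<open>\<rho> / \<delta>\<close> and
      \<open>\<delta> powr (1 / k)\<close> both equal
      \<open>\<rho> powr (1 / Suc k)\<close>.\<close>
    define \<delta> where "\<delta> = \<rho> powr (real k / real (Suc k))"
    define F where "F = (\<lambda>t::real. \<Sum>m\<in>A. c m * cis (2 * pi * of_int m * t))"
    define F' where "F' = (\<lambda>t::real. \<Sum>m\<in>A - {i}. c' m * cis (2 * pi * of_int m * t))"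
    have c'j: "c' j = c j" using i by (simp add: c'_def)
    have \<delta>: "0 < \<delta>" using \<rho> by (simp add: \<delta>_def)
    have [measurable]: "F \<in> borel_measurable borel" "F' \<in> borel_measurable borel"
      unfolding F_def F'_def by (auto intro!: borel_measurable_continuous_onI continuous_intros)
    let ?U = "{t\<in>{0..1}. cmod (F t) \<le> r \<and> \<delta> * cmod (c j) \<le> cmod (F' t)}"
    let ?V = "{t\<in>{0..1}. cmod (F' t) \<le> \<delta> * cmod (c j)}"
    have [measurable]: "?U \<in> sets borel" "?V \<in> sets borel" by measurable
    have "measure lborel ?U \<le> 6 * r / (\<delta> * cmod (c j))"
      unfolding F_def F'_def c'_def
      using Suc.prems \<delta> by (intro measure_trig_poly_deriv_step i) auto
    also have "\<dots> = 6 * \<rho> powr (1 / real (Suc k))"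
    proof -
      have "r / (\<delta> * cmod (c j)) = \<rho> / \<delta>" by (simp add: \<rho>_def)
      also have "\<rho> / \<delta> = \<rho> powr (1 - real k / real (Suc k))"
        using \<rho> by (simp add: \<delta>_def powr_diff)
      also have "1 - real k / real (Suc k) = 1 / real (Suc k)" by (simp add: field_simps)
      finally show ?thesis by simp
    qed
    finally have U: "measure lborel ?U \<le> 6 * \<rho> powr (1 / real (Suc k))" .
    have "measure lborel ?V \<le> 6 * real k * (\<delta> * cmod (c j) / cmod (c' j)) powr (1 / real k)"
      unfolding F'_def using Suc.prems i \<delta> by (intro Suc.IH) (auto simp: c'j)
    also have "\<dots> = 6 * real k * \<rho> powr (1 / real (Suc k))"
      using Suc.prems Suc.hyps by (simp add: c'j \<delta>_def powr_powr del: of_nat_Suc)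
    finally have V: "measure lborel ?V \<le> 6 * real k * \<rho> powr (1 / real (Suc k))" .
    have "?U \<union> ?V \<in> fmeasurable lborel"
      by (rule fmeasurableI2[of "{0..1}"]) (auto simp: fmeasurable_def)
    then have "measure lborel {t\<in>{0..1}. cmod (F t) \<le> r} \<le> measure lborel (?U \<union> ?V)"
      by (intro measure_mono_fmeasurable) auto
    also have "\<dots> \<le> measure lborel ?U + measure lborel ?V"
      by (intro measure_Un_le) auto
    also have "\<dots> \<le> 6 * real (Suc k) * \<rho> powr (1 / real (Suc k))"
      using U V by (simp add: algebra_simps)
    finally show ?thesis by (simp add: F_def \<rho>_def)
  qed
qed

lemma measure_circle_laurent_poly_le:
  fixes b :: "int \<Rightarrow> complex" and B :: "int set"
  assumes B: "finite B" "card B \<le> K" "2 \<le> K" and j: "j \<in> B" "b j \<noteq> 0" and r: "0 < r"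
  shows "{z. cmod z = 1 \<and> cmod (\<Sum>m\<in>B. b m * z powi m) \<le> r} \<in> sets circle_borel" (is "?E \<in> _")
    and "measure circle_measure {z. cmod z = 1 \<and> cmod (\<Sum>m\<in>B. b m * z powi m) \<le> r}
      \<le> 6 * real K * (r / cmod (b j)) powr (1 / (real K - 1))"
proof -
  have [measurable]: "(\<lambda>z. z powi m) \<in> borel_measurable circle_borel" for m :: int
    by (cases "m \<ge> 0") (simp_all add: power_int_def)
  have "{z \<in> space circle_borel. cmod (\<Sum>m\<in>B. b m * z powi m) \<le> r} \<in> sets circle_borel"
    by measurable
  then show E: "?E \<in> sets circle_borel" by simp
  have powi: "cis (2 * pi * t) powi m = cis (2 * pi * of_int m * t)" for t m
    by (simp add: cis_power_int mult_ac)
  let ?F = "\<lambda>t. \<Sum>m\<in>B. b m * cis (2 * pi * of_int m * t)"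
  have [measurable]: "?F \<in> borel_measurable borel"
    by (auto intro!: borel_measurable_continuous_onI continuous_intros)
  have "measure circle_measure ?E = measure lborel {t\<in>{0..<1}. cmod (?F t) \<le> r}"
    unfolding measure_def emeasure_circle_measure[OF E] by (simp add: powi)
  also have "\<dots> \<le> measure lborel {t\<in>{0..1}. cmod (?F t) \<le> r}"
  proof (rule measure_mono_fmeasurable)
    show "{t\<in>{0..1}. cmod (?F t) \<le> r} \<in> fmeasurable lborel"
      by (rule fmeasurableI2[of "{0..1}"]) (auto simp: fmeasurable_def)
  qed auto
  also have "\<dots> \<le> 6 * real (K - 1) * (r / cmod (b j)) powr (1 / real (K - 1))"
    using B j r by (intro measure_trig_poly_le) auto
  also have "\<dots> \<le> 6 * real K * (r / cmod (b j)) powr (1 / (real K - 1))"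
    using B by (auto simp: of_nat_diff intro!: mult_right_mono)
  finally show "measure circle_measure ?E \<le> 6 * real K * (r / cmod (b j)) powr (1 / (real K - 1))" .
qed

subsection \<open>Several variables\<close>

text \<open>The integrand exceeds a level \<open>y\<close> between 0 and 1 only where
  \<open>X \<le> r * y powr (- 1 / p)\<close>, an event of probability at most a constant times
  \<open>y powr (\<alpha> - 1)\<close>. This integrates to \<open>1 / \<alpha>\<close> over the unit
  interval; without the loss of \<open>\<alpha>\<close> in the exponent it would be
  \<open>1 / y\<close>, which is not integrable.\<close>

lemma (in prob_space) nn_integral_truncated_powr_le:
  fixes X :: "'a \<Rightarrow> real"
  assumes X [measurable]: "X \<in> borel_measurable M"
    and p: "0 < p" and r: "0 < r" and \<alpha>: "0 < \<alpha>" and C: "0 \<le> C"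
    and tail: "\<And>s. 0 < s \<Longrightarrow> prob {x \<in> space M. X x \<le> s} \<le> C * s powr ((1 - \<alpha>) * p)"
  shows "(\<integral>\<^sup>+x. ennreal (if X x \<le> r then 1 else (r / X x) powr p) \<partial>M)
    \<le> ennreal (C * r powr ((1 - \<alpha>) * p) / \<alpha>)"
proof -
  define Y where "Y x = (if X x \<le> r then 1 else (r / X x) powr p)" for x
  define D where "D = C * r powr ((1 - \<alpha>) * p)"
  \<comment> \<open>The condition \<open>y < Y x\<close> is relaxed to one that bounds
    \<open>X x\<close> directly, so that after swapping the integrals the inner one is a tail
    probability.\<close>
  define f :: "'a \<Rightarrow> real \<Rightarrow> ennreal" where
    "f x y = (if 0 < y \<and> y < 1 \<and> X x \<le> r * y powr (- 1 / p) then 1 else 0)" for x y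
  interpret P: pair_sigma_finite lborel M ..
  have D: "0 \<le> D" using C by (simp add: D_def)
  have Y1: "0 \<le> Y x" "Y x \<le> 1" for x
    using r p by (auto simp: Y_def intro!: powr_le1)
  \<comment> \<open>If \<open>X x \<le> r\<close>, the threshold is at least \<open>r\<close>
    because \<open>y < 1\<close>; otherwise \<open>y < (r / X x) powr p\<close> is solved for
    \<open>X x\<close>.\<close>
  have imp: "X x \<le> r * y powr (- 1 / p)" if y: "0 < y" "y < Y x" for x y
  proof -
    have y1: "1 \<le> y powr (- 1 / p)"
    proof -
      have "y powr 0 \<le> y powr (- 1 / p)"
        using y Y1(2)[of x] p by (intro powr_mono') auto
      then show ?thesis using y by simp
    qed
    show ?thesis
    proof (cases "X x \<le> r")
      case True
      also have "r * 1 \<le> r * y powr (- 1 / p)" using y1 r by (intro mult_left_mono) auto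
      finally show ?thesis by simp
    next
      case False
      then have "y < (r / X x) powr p" using y by (simp add: Y_def)
      then have "y powr (1 / p) < ((r / X x) powr p) powr (1 / p)"
        using y p by (intro powr_less_mono2) auto
      then have "y powr (1 / p) < r / X x"
        using p r False by (simp add: powr_powr)
      then show ?thesis
        using y r False by (simp add: powr_minus field_simps)
    qed
  qed
  have "(\<integral>\<^sup>+x. ennreal (Y x) \<partial>M) = (\<integral>\<^sup>+x. (\<integral>\<^sup>+y. indicator {0<..<Y x} y \<partial>lborel) \<partial>M)"
    using Y1 by simp
  also have "\<dots> \<le> (\<integral>\<^sup>+x. (\<integral>\<^sup>+y. f x y \<partial>lborel) \<partial>M)"
    using imp Y1 by (intro nn_integral_mono) (auto simp: f_def indicator_def intro: less_le_trans)
  also have "\<dots> = (\<integral>\<^sup>+y. (\<integral>\<^sup>+x. f x y \<partial>M) \<partial>lborel)"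
    unfolding f_def by (rule P.Fubini') measurable
  also have "\<dots> \<le> (\<integral>\<^sup>+y. ennreal (indicator {0..1} y * (D * y powr (\<alpha> - 1))) \<partial>lborel)"
  proof (rule nn_integral_mono)
    fix y :: real
    show "(\<integral>\<^sup>+x. f x y \<partial>M) \<le> ennreal (indicator {0..1} y * (D * y powr (\<alpha> - 1)))"
    proof (cases "0 < y \<and> y < 1")
      case True
      let ?s = "r * y powr (- 1 / p)"
      have "(\<integral>\<^sup>+x. f x y \<partial>M) = (\<integral>\<^sup>+x. indicator {x \<in> space M. X x \<le> ?s} x \<partial>M)"
        using True by (intro nn_integral_cong) (auto simp: f_def indicator_def)
      also have "\<dots> = ennreal (prob {x \<in> space M. X x \<le> ?s})"
        by (simp add: emeasure_eq_measure)
      also have "\<dots> \<le> ennreal (C * ?s powr ((1 - \<alpha>) * p))"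
        using True r by (intro ennreal_leI tail) auto
      also have "C * ?s powr ((1 - \<alpha>) * p) = D * y powr (\<alpha> - 1)"
        using True r p by (simp add: D_def powr_mult powr_powr)
      finally show ?thesis using True by simp
    qed (auto simp: f_def)
  qed
  also have "\<dots> = ennreal (D * (1 / \<alpha>))"
  proof (rule nn_integral_has_integral_lebesgue)
    show "((\<lambda>y. D * y powr (\<alpha> - 1)) has_integral D * (1 / \<alpha>)) {0..1}"
      using has_integral_mult_right[OF has_integral_powr_from_0[of "\<alpha> - 1" 1]] \<alpha> by simp
  qed (use D in auto)
  finally show ?thesis by (simp add: Y_def D_def)
qed

text \<open>
  Keeping the index set abstract lets the coefficients with respect to the last variable be sums
  over subsets of \<open>A\<close>, without changing exponents.
\<close>

definition monomial_sum :: "nat \<Rightarrow> 'a set \<Rightarrow> ('a \<Rightarrow> complex) \<Rightarrow> ('a \<Rightarrow> nat \<Rightarrow> int) \<Rightarrow> (nat \<Rightarrow> complex) \<Rightarrow> complex"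
  where "monomial_sum n A c e z = (\<Sum>v\<in>A. c v * (\<Prod>i<n. z i powi e v i))"

lemma measurable_monomial_sum [measurable]: "monomial_sum n A c e \<in> borel_measurable (torus_borel n)"
proof -
  have [measurable]: "(\<lambda>z. z i powi m) \<in> borel_measurable (torus_borel n)" if i: "i < n" for i m
  proof -
    have "(\<lambda>z. z i) \<in> torus_borel n \<rightarrow>\<^sub>M circle_borel"
      unfolding torus_borel_def using i by (intro measurable_component_singleton) simp
    from measurable_compose[OF this measurable_circle_ident]
    have [measurable]: "(\<lambda>z. z i) \<in> borel_measurable (torus_borel n)" .
    show ?thesis
      by (cases "m \<ge> 0") (simp_all add: power_int_def)
  qed
  show ?thesis
    unfolding monomial_sum_def by (intro borel_measurable_sum borel_measurable_times borel_measurable_prod) auto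
qed

lemma monomial_sum_Suc:
  assumes "finite A"
  shows "monomial_sum (Suc n) A c e (z(n := y)) =
    (\<Sum>m\<in>(\<lambda>v. e v n) ` A. monomial_sum n {v\<in>A. e v n = m} c e z * y powi m)"
proof -
  have "monomial_sum (Suc n) A c e (z(n := y)) = (\<Sum>v\<in>A. c v * (\<Prod>i<n. z i powi e v i) * y powi e v n)"
    by (simp add: monomial_sum_def mult.assoc)
  also have "\<dots> = (\<Sum>m\<in>(\<lambda>v. e v n) ` A. \<Sum>v | v \<in> A \<and> e v n = m. c v * (\<Prod>i<n. z i powi e v i) * y powi e v n)"
    using assms by (rule sum.image_gen)
  also have "\<dots> = (\<Sum>m\<in>(\<lambda>v. e v n) ` A. monomial_sum n {v\<in>A. e v n = m} c e z * y powi m)"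
    unfolding monomial_sum_def sum_distrib_right by (intro sum.cong refl) auto
  finally show ?thesis .
qed

section \<open>Fubini and induction on the number of variables\<close>

text \<open>For fixed \<open>z\<close> the sum is a Laurent polynomial in the last variable with at
  most \<open>K\<close> terms, and \<open>Q z\<close> is its coefficient at the exponent
  \<open>e v0 n\<close>. Where \<open>cmod (Q z) > r\<close> the one-variable bound applies;
  elsewhere the trivial bound 1 is below \<open>6 * K\<close>.\<close>

lemma emeasure_monomial_sum_Suc_le:
  fixes A :: "'a set" and c :: "'a \<Rightarrow> complex" and e :: "'a \<Rightarrow> nat \<Rightarrow> int"
  assumes A: "finite A" "v0 \<in> A" and K: "card ((\<lambda>v. e v n) ` A) \<le> K" "2 \<le> K" and r: "0 < r"
  defines "Q \<equiv> monomial_sum n {v\<in>A. e v n = e v0 n} c e"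
  shows "emeasure (torus_measure (Suc n)) {z \<in> torus (Suc n). cmod (monomial_sum (Suc n) A c e z) \<le> r}
    \<le> ennreal (6 * real K) *
       (\<integral>\<^sup>+z. ennreal (if cmod (Q z) \<le> r then 1 else (r / cmod (Q z)) powr (1 / (real K - 1))) \<partial>torus_measure n)"
proof -
  let ?E = "{z \<in> torus (Suc n). cmod (monomial_sum (Suc n) A c e z) \<le> r}"
  define B where "B = (\<lambda>v. e v n) ` A"
  define b where "b z m = monomial_sum n {v\<in>A. e v n = m} c e z" for z m
  interpret circle: prob_space circle_measure by (rule prob_space_circle_measure)
  interpret product_sigma_finite "\<lambda>_. circle_measure"
    by (intro product_sigma_finite.intro) (simp add: prob_space_imp_sigma_finite prob_space_circle_measure)
  have "{z \<in> space (torus_borel (Suc n)). cmod (monomial_sum (Suc n) A c e z) \<le> r} \<in> sets (torus_borel (Suc n))"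
    by measurable
  then have E: "?E \<in> sets (torus_measure (Suc n))" by simp
  have PiM: "torus_measure (Suc n) = PiM (insert n {..<n}) (\<lambda>_. circle_measure)"
    by (simp add: torus_measure_def lessThan_Suc)
  have [measurable]: "Q \<in> borel_measurable (torus_measure n)"
    unfolding Q_def by measurable
  have "emeasure (torus_measure (Suc n)) ?E = (\<integral>\<^sup>+z. indicator ?E z \<partial>torus_measure (Suc n))"
    using E by simp
  also have "\<dots> = (\<integral>\<^sup>+z. (\<integral>\<^sup>+y. indicator ?E (z(n := y)) \<partial>circle_measure) \<partial>torus_measure n)"
    unfolding PiM unfolding torus_measure_def
    using E unfolding PiM by (intro product_nn_integral_insert) auto
  also have "\<dots> \<le> (\<integral>\<^sup>+z. ennreal (6 * real K) *
      ennreal (if cmod (Q z) \<le> r then 1 else (r / cmod (Q z)) powr (1 / (real K - 1))) \<partial>torus_measure n)"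
  proof (rule nn_integral_mono)
    fix z assume "z \<in> space (torus_measure n)"
    then have z: "z \<in> torus n" by simp
    let ?F = "{y. cmod y = 1 \<and> cmod (\<Sum>m\<in>B. b z m * y powi m) \<le> r}"
    have upd: "z(n := y) \<in> torus (Suc n) \<longleftrightarrow> cmod y = 1" for y
      using z by (auto simp: torus_def PiE_iff extensional_def less_Suc_eq)
    have "(\<integral>\<^sup>+y. indicator ?E (z(n := y)) \<partial>circle_measure) = (\<integral>\<^sup>+y. indicator ?F y \<partial>circle_measure)"
      unfolding indicator_def mem_Collect_eq upd monomial_sum_Suc[OF A(1)] B_def b_def ..
    also have "\<dots> \<le> ennreal (6 * real K * (if cmod (Q z) \<le> r then 1 else (r / cmod (Q z)) powr (1 / (real K - 1))))"
    proof (cases "cmod (Q z) \<le> r")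
      case True
      have "(\<integral>\<^sup>+y. indicator ?F y \<partial>circle_measure) \<le> (\<integral>\<^sup>+y. 1 \<partial>circle_measure)"
        by (intro nn_integral_mono) (auto simp: indicator_def)
      also have "\<dots> = ennreal 1" using circle.emeasure_space_1 by simp
      also have "\<dots> \<le> ennreal (6 * real K)" using K by (intro ennreal_leI) simp
      finally show ?thesis using True by simp
    next
      case False
      have Q: "b z (e v0 n) = Q z" by (simp add: b_def Q_def)
      then have nz: "b z (e v0 n) \<noteq> 0" using False r by auto
      have "finite B" "card B \<le> K" "e v0 n \<in> B" using A K by (auto simp: B_def)
      note circ = measure_circle_laurent_poly_le[OF this(1,2) K(2) this(3), of "b z", OF nz r]
      have "(\<integral>\<^sup>+y. indicator ?F y \<partial>circle_measure) = ennreal (measure circle_measure ?F)"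
        using circ(1) by (simp add: circle.emeasure_eq_measure)
      also have "\<dots> \<le> ennreal (6 * real K * (r / cmod (Q z)) powr (1 / (real K - 1)))"
        using circ(2) unfolding Q by (rule ennreal_leI)
      finally show ?thesis using False by simp
    qed
    finally show "(\<integral>\<^sup>+y. indicator ?E (z(n := y)) \<partial>circle_measure) \<le> ennreal (6 * real K) *
      ennreal (if cmod (Q z) \<le> r then 1 else (r / cmod (Q z)) powr (1 / (real K - 1)))"
      by (simp add: ennreal_mult'[symmetric])
  qed
  also have "\<dots> = ennreal (6 * real K) *
      (\<integral>\<^sup>+z. ennreal (if cmod (Q z) \<le> r then 1 else (r / cmod (Q z)) powr (1 / (real K - 1))) \<partial>torus_measure n)"
    by (intro nn_integral_cmult) measurable
  finally show ?thesis .
qed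

text \<open>Dropping a variable passes to the terms that share the last exponent of
  \<open>v0\<close>, so \<open>c v0\<close> is never lost, and costs a factor
  \<open>6 * K / \<alpha>\<close>. The common bound \<open>K\<close> for all variables keeps the
  exponent of \<open>r\<close> the same throughout.\<close>

lemma measure_monomial_sum_le:
  fixes A :: "'a set" and c :: "'a \<Rightarrow> complex" and e :: "'a \<Rightarrow> nat \<Rightarrow> int"
  assumes "1 \<le> n" "finite A" "v0 \<in> A" "c v0 \<noteq> 0" "0 < r"
    and "\<And>u v. u \<in> A \<Longrightarrow> v \<in> A \<Longrightarrow> (\<And>i. i < n \<Longrightarrow> e u i = e v i) \<Longrightarrow> u = v"
    and "\<And>i. i < n \<Longrightarrow> card ((\<lambda>v. e v i) ` A) \<le> K"
    and K: "2 \<le> K" and \<alpha>: "0 < \<alpha>" "\<alpha> < 1"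
  shows "measure (torus_measure n) {z \<in> torus n. cmod (monomial_sum n A c e z) \<le> r}
    \<le> 6 * real K * (6 * real K / \<alpha>) ^ (n - 1) * (r / cmod (c v0)) powr ((1 - \<alpha>) / (real K - 1))"
  using assms(1-7)
proof (induction n arbitrary: A r rule: nat_induct_at_least)
  case (base A r)
  define Q where "Q = monomial_sum 0 {v\<in>A. e v 0 = e v0 0} c e"
  let ?L = "cmod (c v0)"
  interpret T: prob_space "torus_measure d" for d by (rule prob_space_torus_measure)
  have L: "0 < ?L" using base by simp
  \<comment> \<open>In dimension one distinct terms have distinct exponents, so \<open>Q\<close> is
    the constant \<open>c v0\<close> on the one-point torus of dimension 0.\<close>
  have "{v\<in>A. e v 0 = e v0 0} = {v0}"
    using base(2) base(5)[of _ v0] by auto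
  then have Q: "Q z = c v0" for z by (simp add: Q_def monomial_sum_def)
  \<comment> \<open>No factor \<open>1 / \<alpha>\<close> arises here: lowering the exponent
    enlarges a power with base below 1, and for \<open>?L \<le> r\<close> the right-hand side is at
    least 1.\<close>
  have "(if ?L \<le> r then 1 else (r / ?L) powr (1 / (real K - 1))) \<le> (r / ?L) powr ((1 - \<alpha>) / (real K - 1))"
    using L base(4) K \<alpha> by (auto intro!: ge_one_powr_ge_zero powr_mono' divide_right_mono)
  then have *: "ennreal (6 * real K) * ennreal (if ?L \<le> r then 1 else (r / ?L) powr (1 / (real K - 1)))
      \<le> ennreal (6 * real K) * ennreal ((r / ?L) powr ((1 - \<alpha>) / (real K - 1)))"
    by (intro mult_left_mono ennreal_leI) auto
  have "emeasure (torus_measure 1) {z \<in> torus 1. cmod (monomial_sum 1 A c e z) \<le> r} \<le> ennreal (6 * real K) *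
       (\<integral>\<^sup>+z. ennreal (if cmod (Q z) \<le> r then 1 else (r / cmod (Q z)) powr (1 / (real K - 1))) \<partial>torus_measure 0)"
    unfolding Q_def One_nat_def by (rule emeasure_monomial_sum_Suc_le) (use base K in auto)
  also have "\<dots> = ennreal (6 * real K) * ennreal (if ?L \<le> r then 1 else (r / ?L) powr (1 / (real K - 1)))"
    unfolding Q using T.emeasure_space_1[of 0] by simp
  also note *
  also have "ennreal (6 * real K) * ennreal ((r / ?L) powr ((1 - \<alpha>) / (real K - 1)))
      = ennreal (6 * real K * (r / ?L) powr ((1 - \<alpha>) / (real K - 1)))"
    by (rule ennreal_mult'[symmetric]) simp
  finally show ?case
    by (simp add: T.emeasure_eq_measure)
next
  case (Suc n A r)
  define A' where "A' = {v\<in>A. e v n = e v0 n}"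
  define Q where "Q = monomial_sum n A' c e"
  define D where "D = 6 * real K * (6 * real K / \<alpha>) ^ (n - 1)"
  define p where "p = 1 / (real K - 1)"
  let ?L = "cmod (c v0)"
  interpret T: prob_space "torus_measure d" for d by (rule prob_space_torus_measure)
  have L: "0 < ?L" using Suc.prems by simp
  have D: "0 \<le> D" using \<alpha> by (simp add: D_def)
  have p: "0 < p" using K by (simp add: p_def)
  have pe: "(1 - \<alpha>) / (real K - 1) = (1 - \<alpha>) * p" by (simp add: p_def)
  \<comment> \<open>Read as a function of the level \<open>s\<close>, the induction hypothesis is
    the tail bound that the layer cake estimate requires.\<close>
  have IH: "T.prob n {z \<in> space (torus_measure n). cmod (Q z) \<le> s} \<le> D / ?L powr ((1 - \<alpha>) * p) * s powr ((1 - \<alpha>) * p)"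
    if s: "0 < s" for s
  proof -
    have "measure (torus_measure n) {z \<in> torus n. cmod (Q z) \<le> s}
        \<le> D * (s / cmod (c v0)) powr ((1 - \<alpha>) / (real K - 1))"
      unfolding D_def Q_def
    proof (rule Suc.IH)
      \<comment> \<open>Terms of \<open>A'\<close> agree in the last exponent, so the remaining
        exponents still separate them.\<close>
      show "u = v" if "u \<in> A'" "v \<in> A'" "\<And>i. i < n \<Longrightarrow> e u i = e v i" for u v
        using that by (intro Suc.prems(5)) (auto simp: A'_def less_Suc_eq)
      show "card ((\<lambda>v. e v i) ` A') \<le> K" if "i < n" for i
      proof -
        have "card ((\<lambda>v. e v i) ` A') \<le> card ((\<lambda>v. e v i) ` A)"
          using Suc.prems(1) by (intro card_mono) (auto simp: A'_def)
        then show ?thesis using Suc.prems(6)[of i] that by simp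
      qed
    qed (use Suc.prems s in \<open>auto simp: A'_def\<close>)
    then show ?thesis using s L by (simp add: pe powr_divide)
  qed
  have "emeasure (torus_measure (Suc n)) {z \<in> torus (Suc n). cmod (monomial_sum (Suc n) A c e z) \<le> r}
      \<le> ennreal (6 * real K) *
       (\<integral>\<^sup>+z. ennreal (if cmod (Q z) \<le> r then 1 else (r / cmod (Q z)) powr p) \<partial>torus_measure n)"
    unfolding Q_def A'_def p_def using Suc.prems K by (intro emeasure_monomial_sum_Suc_le) auto
  also have "\<dots> \<le> ennreal (6 * real K) * ennreal (D / ?L powr ((1 - \<alpha>) * p) * r powr ((1 - \<alpha>) * p) / \<alpha>)"
  proof (intro mult_left_mono T.nn_integral_truncated_powr_le IH p)
    have [measurable]: "Q \<in> borel_measurable (torus_measure n)"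
      unfolding Q_def by measurable
    show "(\<lambda>z. cmod (Q z)) \<in> borel_measurable (torus_measure n)" by measurable
  qed (use Suc.prems \<alpha> D in auto)
  also have "\<dots> = ennreal (6 * real K * (D / ?L powr ((1 - \<alpha>) * p) * r powr ((1 - \<alpha>) * p) / \<alpha>))"
    by (rule ennreal_mult'[symmetric]) simp
  also have "6 * real K * (D / ?L powr ((1 - \<alpha>) * p) * r powr ((1 - \<alpha>) * p) / \<alpha>)
      = D * (6 * real K / \<alpha>) * (r / ?L) powr ((1 - \<alpha>) * p)"
    using L Suc.prems(4) by (simp add: powr_divide mult_ac)
  \<comment> \<open>\<open>1 \<le> n\<close> rules out truncated subtraction in
    \<open>n - 1\<close>, so one more factor raises the power by exactly one.\<close>
  also have "D * (6 * real K / \<alpha>) = 6 * real K * (6 * real K / \<alpha>) ^ (Suc n - 1)"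
    using Suc.hyps unfolding D_def by (cases n) simp_all
  finally show ?case
    unfolding pe using \<alpha> by (simp add: T.emeasure_eq_measure)
qed

section \<open>Exponents and coefficients of Laurent polynomials\<close>

text \<open>Terms of \<open>P\<close> with the same exponent at \<open>i\<close> stay distinct after
  this exponent is removed, so no cancellation can make their joint coefficient vanish.\<close>

lemma num_coeffs_in_eq: "num_coeffs_in i P = card ((\<lambda>v. Poly_Mapping.lookup v i) ` Poly_Mapping.keys P)"
proof -
  have "coeff_in i P m \<noteq> 0 \<longleftrightarrow> m \<in> (\<lambda>v. Poly_Mapping.lookup v i) ` Poly_Mapping.keys P" for m
  proof
    assume "coeff_in i P m \<noteq> 0"
    then obtain w where "Poly_Mapping.lookup (coeff_in i P m) w \<noteq> 0"
      by (metis poly_mapping_eqI lookup_zero)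
    then have "Poly_Mapping.lookup w i = 0" "w + Poly_Mapping.single i m \<in> Poly_Mapping.keys P"
      by (auto simp: lookup_coeff_in in_keys_iff split: if_splits)
    then show "m \<in> (\<lambda>v. Poly_Mapping.lookup v i) ` Poly_Mapping.keys P"
      by (intro image_eqI[of _ _ "w + Poly_Mapping.single i m"]) (auto simp: lookup_add)
  next
    assume "m \<in> (\<lambda>v. Poly_Mapping.lookup v i) ` Poly_Mapping.keys P"
    then obtain v where v: "v \<in> Poly_Mapping.keys P" "m = Poly_Mapping.lookup v i" by auto
    then have "Poly_Mapping.lookup (coeff_in i P m) (v - Poly_Mapping.single i m) \<noteq> 0"
      by (simp add: lookup_coeff_in lookup_minus in_keys_iff)
    then show "coeff_in i P m \<noteq> 0" by auto
  qed
  then show ?thesis by (simp add: num_coeffs_in_def)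
qed

lemma obtain_L_inf:
  assumes "P \<noteq> 0"
  obtains v where "v \<in> Poly_Mapping.keys P" "cmod (Poly_Mapping.lookup P v) = L_inf P" "0 < L_inf P"
proof -
  let ?R = "range (\<lambda>v. cmod (Poly_Mapping.lookup P v))"
  \<comment> \<open>All but finitely many coefficients are 0, so the range is finite and
    \<open>Max\<close> is a genuine maximum.\<close>
  have "?R \<subseteq> insert 0 ((\<lambda>v. cmod (Poly_Mapping.lookup P v)) ` Poly_Mapping.keys P)"
    by (auto simp: in_keys_iff)
  then have fin: "finite ?R" by (rule finite_subset) simp
  then have "Max ?R \<in> ?R" by (intro Max_in) auto
  then obtain v where v: "cmod (Poly_Mapping.lookup P v) = L_inf P" by (auto simp: L_inf_def)
  obtain u where "Poly_Mapping.lookup P u \<noteq> 0"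
    using assms by (metis poly_mapping_eqI lookup_zero)
  then have "0 < cmod (Poly_Mapping.lookup P u)" by simp
  also have "\<dots> \<le> L_inf P" unfolding L_inf_def using fin by (intro Max_ge) auto
  finally have "0 < L_inf P" .
  then show ?thesis using v by (intro that[of v]) (auto simp: in_keys_iff)
qed

text \<open>Exponents are indexed by all naturals, but for keys of such a \<open>P\<close> those at
  indices \<open>n\<close> and above vanish.\<close>

lemma laurent_polys_keys_eqI:
  assumes "P \<in> laurent_polys n" "u \<in> Poly_Mapping.keys P" "v \<in> Poly_Mapping.keys P"
    and "\<And>i. i < n \<Longrightarrow> Poly_Mapping.lookup u i = Poly_Mapping.lookup v i"
  shows "u = v"
proof (rule poly_mapping_eqI)
  fix i
  show "Poly_Mapping.lookup u i = Poly_Mapping.lookup v i"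
  proof (cases "i < n")
    case False
    then have "i \<notin> Poly_Mapping.keys u" "i \<notin> Poly_Mapping.keys v"
      using assms(1-3) by (auto simp: laurent_polys_def)
    then show ?thesis by (simp add: in_keys_iff)
  qed (rule assms(4))
qed

lemma num_coeffs_in_le_kappa: "i < n \<Longrightarrow> num_coeffs_in i P \<le> kappa n P"
  unfolding kappa_def by (intro Max_ge) auto

lemma kappa_le_num_coeffs:
  assumes "1 \<le> n"
  shows "kappa n P \<le> num_coeffs P"
proof -
  have "num_coeffs_in i P \<le> num_coeffs P" for i
    unfolding num_coeffs_in_eq num_coeffs_def using card_image_le[of "Poly_Mapping.keys P"]
    by (simp add: keys.rep_eq)
  then show ?thesis
    unfolding kappa_def using assms by (subst Max_le_iff) (auto simp: lessThan_empty_iff)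
qed

text \<open>If each variable occurred with at most one exponent, all keys would coincide. The bound
  makes the denominator \<open>\<kappa> - 1\<close> positive.\<close>

lemma kappa_ge_2:
  assumes "P \<in> laurent_polys n" "2 \<le> num_coeffs P"
  shows "2 \<le> kappa n P"
proof (rule ccontr)
  assume "\<not> 2 \<le> kappa n P"
  then have le1: "card ((\<lambda>v. Poly_Mapping.lookup v i) ` Poly_Mapping.keys P) \<le> Suc 0" if "i < n" for i
    using num_coeffs_in_le_kappa[OF that, of P] by (simp add: num_coeffs_in_eq)
  have "card (Poly_Mapping.keys P) \<le> Suc 0"
    unfolding card_le_Suc0_iff_eq[OF finite_keys]
  proof (intro ballI)
    fix u v assume uv: "u \<in> Poly_Mapping.keys P" "v \<in> Poly_Mapping.keys P"
    show "u = v"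
    proof (rule laurent_polys_keys_eqI[OF assms(1) uv])
      fix i assume "i < n"
      from le1[OF this] show "Poly_Mapping.lookup u i = Poly_Mapping.lookup v i"
        unfolding card_le_Suc0_iff_eq[OF finite_imageI[OF finite_keys]] using uv by blast
    qed
  qed
  then show False using assms(2) by (simp add: num_coeffs_def keys.rep_eq)
qed

theorem theorem4p5:
  fixes n k \<kappa> :: nat and P :: laurent and \<alpha> r :: real
  assumes "n \<ge> 1"
    and "P \<in> laurent_polys n"
    and "k = num_coeffs P"
    and "k \<ge> 2"
    and "\<kappa> = kappa n P"
    and "0 < \<alpha>" and "\<alpha> < 1"
    and "r > 0"
  shows "measure (torus_measure n) (sublevel n P r)
    \<le> C1 n k * \<alpha> powi (1 - int n) * (r / L_inf P) powr ((1 - \<alpha>) / (real \<kappa> - 1))"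
proof -
  have "P \<noteq> 0" using assms by (auto simp: num_coeffs_def)
  then obtain v0 where v0: "v0 \<in> Poly_Mapping.keys P" "cmod (Poly_Mapping.lookup P v0) = L_inf P" "0 < L_inf P"
    by (rule obtain_L_inf)
  have \<kappa>: "2 \<le> \<kappa>" "\<kappa> \<le> k"
    using assms kappa_ge_2[of P n] kappa_le_num_coeffs[of n P] by auto
  have "sublevel n P r = {z \<in> torus n. cmod (monomial_sum n (Poly_Mapping.keys P) (Poly_Mapping.lookup P) Poly_Mapping.lookup z) \<le> r}"
    by (simp add: sublevel_def laurent_eval_def monomial_sum_def)
  also have "measure (torus_measure n) \<dots> \<le> 6 * real \<kappa> * (6 * real \<kappa> / \<alpha>) ^ (n - 1) *
      (r / cmod (Poly_Mapping.lookup P v0)) powr ((1 - \<alpha>) / (real \<kappa> - 1))"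
  proof (rule measure_monomial_sum_le)
    show "card ((\<lambda>v. Poly_Mapping.lookup v i) ` Poly_Mapping.keys P) \<le> \<kappa>" if "i < n" for i
      using num_coeffs_in_le_kappa[OF that, of P] assms(5) by (simp add: num_coeffs_in_eq)
  qed (use assms v0 \<kappa> laurent_polys_keys_eqI[OF assms(2)] in auto)
  also have "\<dots> \<le> C1 n k * \<alpha> powi (1 - int n) * (r / cmod (Poly_Mapping.lookup P v0)) powr ((1 - \<alpha>) / (real \<kappa> - 1))"
  proof (rule mult_right_mono)
    have "1 - int n = - int (n - 1)" using assms(1) by simp
    then have powi: "\<alpha> powi (1 - int n) = 1 / \<alpha> ^ (n - 1)"
      by (simp only: power_int_minus power_int_of_nat inverse_eq_divide)
    \<comment> \<open>The constant obtained so far has \<open>6 * \<kappa>\<close> in place of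
      \<open>18 * n * k ^ 2\<close>; it is weakened through \<open>\<kappa> \<le> k\<close> and
      \<open>1 \<le> 3 * n * k\<close>.\<close>
    have "1 * 1 \<le> (3 * real n) * real k" using assms by (intro mult_mono) auto
    then have "1 * real \<kappa> \<le> (3 * real n * real k) * real k" using \<kappa> by (intro mult_mono) auto
    then have "6 * real \<kappa> \<le> 18 * real n * real k ^ 2"
      by (simp add: power2_eq_square mult_ac)
    then have "(6 * real \<kappa>) ^ (n - 1) \<le> (18 * real n * real k ^ 2) ^ (n - 1)"
      by (rule power_mono) simp
    then have "6 * real \<kappa> * (6 * real \<kappa>) ^ (n - 1) \<le> C1 n k"
      unfolding C1_def using \<kappa> by (intro mult_mono) auto
    then show "6 * real \<kappa> * (6 * real \<kappa> / \<alpha>) ^ (n - 1) \<le> C1 n k * \<alpha> powi (1 - int n)"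
      unfolding powi power_divide using assms by (simp add: divide_right_mono)
  qed simp
  finally show ?thesis using v0 by simp
qed

end
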